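(* Let $\tilde\Omega_e=[0,1]^2\times\{\pm1\}$ and let $\tilde F_e:\tilde\Omega_e\to\tilde\Omega_e$ be given by $$\tilde F_e(x,y,\delta)=\begin{cases}\big(\overline{F}_e(x,y),\delta\big), & x\in[0,\frac13)\cup[\frac12,1],\\ \big(\overline{F}_e(x,y),-\delta\big), & x\in[\frac13,\frac12).\end{cases}$$ The map $K_e:\mathcal{T}_e\to\tilde\Omega_e$, $K_e(x,y)=\left(\frac{\epsilon}{x},\frac{1}{2-\epsilon y},\epsilon\right)$, where $\epsilon=\operatorname{sign}(x)$, is invertible and $$K_e\,\sigma_e=\tilde F_e\,K_e.$$ Furthermore, the pushforward (under $\pi\circ K_e$) of the invariant measure $\frac{d\alpha\,d\beta}{(\alpha-\beta)^2}$ for $\sigma_e$ is invariant for $\overline{F}_e$ and is given by $$\frac{dx\,dy}{(x+y-2xy)^2}.$$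
   Context: Let $\mathcal{T}_e=\pm\big((1,\infty)\times(-\infty,1)\big)$, that is, $\mathcal{T}_e=\big((1,\infty)\times(-\infty,1)\big)\cup\big((-\infty,-1)\times(-1,\infty)\big)\subset\mathbb{R}^2$. The map $\sigma_e$ on $\mathcal{T}_e$ is defined, with $\epsilon=\operatorname{sign}(x)\in\{\pm1\}$, by $$\sigma_e(x,y)=\begin{cases}(x-2\epsilon,\;y-2\epsilon), & \epsilon x\in(3,\infty),\\ \left(\frac{1}{2\epsilon-x},\frac{1}{2\epsilon-y}\right), & \epsilon x\in(1,3].\end{cases}$$ Here $(\alpha,\beta)$ denote the coordinates on $\mathcal{T}_e$, and $\frac{d\alpha\,d\beta}{(\alpha-\beta)^2}$ is the measure with density $(\alpha-\beta)^{-2}$ with respect to Lebesgue measure. The map $\overline{F}_e:[0,1]^2\to[0,1]^2$ (the natural extension of the even Farey map) is $$\overline{F}_e(x,y)=\begin{cases}\left(\frac{x}{1-2x},\frac{y}{1+2y}\right), & x\in[0,\frac13),\\ \left(\frac{1-2x}{x},\frac{1}{2+y}\right), & x\in[\frac13,\frac12),\\ \left(\frac{2x-1}{x},\frac{1}{2-y}\right), & x\in[\frac12,1].\end{cases}$$ The projection $\pi:\tilde\Omega_e\to[0,1]^2$ is $\pi(x,y,\delta)=(x,y)$.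
   Formalization: K_e is shown bijective onto (0,1)²×{±1} (its complement is null), not all of Ω̃_e; K_eσ_e = F̃_eK_e is stated off |x|=2, where σ_e is undefined; the pushforward under π∘K_e is 2dxdy/(x+y−2xy)², as both sheets contribute; the unscaled measure is also shown invariant. *)

theory Defs
  imports "HOL-Analysis.Analysis"
begin

definition T_e :: "(real \<times> real) set" where
  "T_e = {1<..} \<times> {..<1} \<union> {..<-1} \<times> {-1<..}"

(* On T_e the else-branch is exactly the case 1 < \<epsilon> x \<le> 3.  For |x| = 2 the formula of that
   branch has a pole (and yields the value 0 in its first coordinate, by 1 / 0 = 0); for
   |x| = 3 it is defined, but its value lies on the boundary line |x| = 1 of T_e. *)
definition sigma_e :: "real \<times> real \<Rightarrow> real \<times> real" where
  "sigma_e = (\<lambda>(x, y). let \<epsilon> = sgn x in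
     if \<epsilon> * x > 3 then (x - 2 * \<epsilon>, y - 2 * \<epsilon>)
     else (1 / (2 * \<epsilon> - x), 1 / (2 * \<epsilon> - y)))"

definition unit_square :: "(real \<times> real) set" where
  "unit_square = {0..1} \<times> {0..1}"

definition F_bar_e :: "real \<times> real \<Rightarrow> real \<times> real" where
  "F_bar_e = (\<lambda>(x, y).
     if x < 1/3 then (x / (1 - 2 * x), y / (1 + 2 * y))
     else if x < 1/2 then ((1 - 2 * x) / x, 1 / (2 + y))
     else ((2 * x - 1) / x, 1 / (2 - y)))"

(* The sign \<delta> is kept as a real number, so that it can be sgn x. *)
definition Omega_e :: "(real \<times> real \<times> real) set" where
  "Omega_e = {(x, y, \<delta>). (x, y) \<in> unit_square \<and> \<delta> \<in> {1, -1}}"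

definition proj_e :: "real \<times> real \<times> real \<Rightarrow> real \<times> real" where
  "proj_e = (\<lambda>(x, y, \<delta>). (x, y))"

definition F_tilde_e :: "real \<times> real \<times> real \<Rightarrow> real \<times> real \<times> real" where
  "F_tilde_e = (\<lambda>(x, y, \<delta>).
     (fst (F_bar_e (x, y)), snd (F_bar_e (x, y)), if x \<in> {1/3..<1/2} then - \<delta> else \<delta>))"

definition K_e :: "real \<times> real \<Rightarrow> real \<times> real \<times> real" where
  "K_e = (\<lambda>(x, y). let \<epsilon> = sgn x in (\<epsilon> / x, 1 / (2 - \<epsilon> * y), \<epsilon>))"

(* Measures on T_e and on the unit square are represented as Borel measures on the whole plane
   that vanish outside these sets; the values of the maps outside are then irrelevant. *)
definition mu_sigma_e :: "(real \<times> real) measure" where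
  "mu_sigma_e = density lborel
     (\<lambda>(\<alpha>, \<beta>). ennreal (indicator T_e (\<alpha>, \<beta>) / (\<alpha> - \<beta>)\<^sup>2))"

definition mu_F_e :: "(real \<times> real) measure" where
  "mu_F_e = density lborel
     (\<lambda>(x, y). ennreal (indicator unit_square (x, y) / (x + y - 2 * x * y)\<^sup>2))"

definition invariant_measure :: "('a \<Rightarrow> 'a) \<Rightarrow> 'a measure \<Rightarrow> bool" where
  "invariant_measure f M \<longleftrightarrow> f \<in> measurable M M \<and> distr M M f = M"

end

theory Submission
  imports Defs
begin

text \<open>
  On each branch \<^term>\<open>sigma_e\<close> acts on both coordinates by one Moebius map \<open>m\<close> with
  \<open>(m x - m y)\<^sup>2 = (x - y)\<^sup>2 \<bar>m' x m' y\<bar>\<close>, so it preserves the measure with density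
  \<open>1 / (\<alpha> - \<beta>)\<^sup>2\<close>; the branches live on rectangles whose images tile \<^term>\<open>T_e\<close> up to null sets.
  Both halves of \<^term>\<open>T_e\<close> are carried by \<^term>\<open>proj_e \<circ> K_e\<close> onto the open unit square, each
  contributing one copy of \<^term>\<open>mu_F_e\<close>, whence the factor 2. The invariance of \<^term>\<open>mu_F_e\<close> is
  inherited from \<^term>\<open>mu_sigma_e\<close> through the semiconjugacy.
\<close>

section \<open>Change of variables for nonnegative integrals\<close>

text \<open>The map \<open>g\<close> carries the measure on \<open>A\<close> with density
  \<open>\<bar>g' x\<bar>\<close> to Lebesgue measure on \<open>C\<close>. This is checked on sets,
  by change of variables for absolutely integrable indicators; arbitrary nonnegative
  \<open>f\<close> follows by integrating against the two equal measures.\<close>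

lemma nn_integral_substitution_inj:
  fixes g g' :: "real \<Rightarrow> real" and f :: "real \<Rightarrow> ennreal"
  assumes A [measurable]: "A \<in> sets borel" and C [measurable]: "C \<in> sets borel"
    and bij: "bij_betw g A C"
    and deriv: "\<And>x. x \<in> A \<Longrightarrow> (g has_real_derivative g' x) (at x)"
    and g [measurable]: "g \<in> borel_measurable borel"
    and g' [measurable]: "g' \<in> borel_measurable borel"
    and f [measurable]: "f \<in> borel_measurable borel"
  shows "(\<integral>\<^sup>+x. indicator A x * (f (g x) * ennreal \<bar>g' x\<bar>) \<partial>lborel) = (\<integral>\<^sup>+y. indicator C y * f y \<partial>lborel)"
proof -
  \<comment> \<open>The value is infinite exactly when absolute integrability fails, so infinite
    integrals need no separate treatment later.\<close>
  have nn: "(\<integral>\<^sup>+x. ennreal (indicator S x * h x) \<partial>lborel)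
      = (if h absolutely_integrable_on S then ennreal (integral S h) else \<infinity>)"
    if [measurable]: "S \<in> sets borel" "h \<in> borel_measurable borel" and h: "\<And>x. h x \<ge> 0"
    for S and h :: "real \<Rightarrow> real"
  proof -
    let ?h = "\<lambda>x. indicator S x * h x"
    have [simp]: "h absolutely_integrable_on S \<longleftrightarrow> integrable lborel ?h"
      unfolding set_integrable_def by (simp add: integrable_completion)
    show ?thesis
    proof (cases "integrable lborel ?h")
      case True
      then have "h absolutely_integrable_on S" by simp
      then have "integral S h = (\<integral>x. ?h x \<partial>lborel)"
        by (subst set_lebesgue_integral_eq_integral(2)[symmetric])
          (simp_all add: set_lebesgue_integral_def integral_completion)
      with True h show ?thesis by (simp add: nn_integral_eq_integral)
    next
      case False
      then have "\<not> (\<integral>\<^sup>+x. ennreal (?h x) \<partial>lborel) < \<infinity>"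
        using h by (auto simp: integrable_iff_bounded abs_mult)
      with False show ?thesis by (simp add: not_less top_unique)
    qed
  qed
  have "distr (density lborel (\<lambda>x. indicator A x * ennreal \<bar>g' x\<bar>)) borel g
      = density lborel (indicator C)" (is "?M = ?N")
  proof (rule measure_eqI)
    fix X assume "X \<in> sets ?M"
    then have X [measurable]: "X \<in> sets borel" by simp
    have [measurable]: "g -` X \<in> sets borel"
      using measurable_sets[OF g X] by simp
    \<comment> \<open>Since \<open>b\<close> is arbitrary, this equivalence yields both that the two
      sides are integrable together and that their integrals agree.\<close>
    have "(\<lambda>x. \<bar>g' x\<bar> *\<^sub>R (indicator X (g x) :: real)) absolutely_integrable_on A \<and>
        integral A (\<lambda>x. \<bar>g' x\<bar> *\<^sub>R (indicator X (g x) :: real)) = b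
      \<longleftrightarrow> (indicator X :: real \<Rightarrow> real) absolutely_integrable_on C \<and>
        integral C (indicator X :: real \<Rightarrow> real) = b" for b
      using has_absolute_integral_change_of_variables_1'[of A g g' "indicator X" b] bij
        deriv[THEN has_field_derivative_at_within] A
      by (simp add: bij_betw_def)
    then have eq: "(\<integral>\<^sup>+x. ennreal (indicator A x * (\<bar>g' x\<bar> *\<^sub>R (indicator X (g x) :: real))) \<partial>lborel)
        = (\<integral>\<^sup>+x. ennreal (indicator C x * (indicator X x :: real)) \<partial>lborel)"
      by (subst (1 2) nn) (auto, metis)
    have "emeasure ?M X = (\<integral>\<^sup>+x. ennreal (indicator A x * (\<bar>g' x\<bar> *\<^sub>R (indicator X (g x) :: real))) \<partial>lborel)"
      by (auto simp: emeasure_distr emeasure_density intro!: nn_integral_cong split: split_indicator)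
    also have "\<dots> = emeasure ?N X"
      unfolding eq by (auto simp: emeasure_density intro!: nn_integral_cong split: split_indicator)
    finally show "emeasure ?M X = emeasure ?N X" .
  qed simp
  then have "(\<integral>\<^sup>+y. f y \<partial>?M) = (\<integral>\<^sup>+y. f y \<partial>?N)" by simp
  then show ?thesis
    by (simp add: nn_integral_distr nn_integral_density ac_simps)
qed

text \<open>Map and Jacobian factor over the coordinates, so Tonelli reduces the claim to a
  substitution in the inner variable followed by one in the outer variable.\<close>

lemma nn_integral_substitution_rectangle:
  fixes g g' h h' :: "real \<Rightarrow> real" and f :: "real \<times> real \<Rightarrow> ennreal"
  assumes [measurable]: "A \<in> sets borel" "B \<in> sets borel" "C \<in> sets borel" "D \<in> sets borel"
    and bij: "bij_betw g A C" "bij_betw h B D"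
    and deriv: "\<And>x. x \<in> A \<Longrightarrow> (g has_real_derivative g' x) (at x)"
      "\<And>y. y \<in> B \<Longrightarrow> (h has_real_derivative h' y) (at y)"
    and [measurable]: "g \<in> borel_measurable borel" "g' \<in> borel_measurable borel"
      "h \<in> borel_measurable borel" "h' \<in> borel_measurable borel"
    and [measurable]: "f \<in> borel_measurable borel"
  shows "(\<integral>\<^sup>+(x, y). indicator (A \<times> B) (x, y) * (f (g x, h y) * ennreal \<bar>g' x * h' y\<bar>) \<partial>lborel)
    = (\<integral>\<^sup>+p. indicator (C \<times> D) p * f p \<partial>lborel)"
proof -
  have [measurable]: "f \<in> borel_measurable (borel \<Otimes>\<^sub>M borel)"
    by (simp add: borel_prod)
  have [measurable]: "C \<times> D \<in> sets borel"
    by (simp flip: borel_prod)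
  have "(\<integral>\<^sup>+(x, y). indicator (A \<times> B) (x, y) * (f (g x, h y) * ennreal \<bar>g' x * h' y\<bar>) \<partial>lborel)
      = (\<integral>\<^sup>+x. \<integral>\<^sup>+y. indicator A x * ennreal \<bar>g' x\<bar>
          * (indicator B y * (f (g x, h y) * ennreal \<bar>h' y\<bar>)) \<partial>lborel \<partial>lborel)"
    by (subst lborel_prod[symmetric], subst lborel.nn_integral_fst[symmetric])
      (auto simp: indicator_times abs_mult ennreal_mult ac_simps)
  also have "\<dots> = (\<integral>\<^sup>+x. indicator A x * ((\<integral>\<^sup>+y. indicator D y * f (g x, y) \<partial>lborel) * ennreal \<bar>g' x\<bar>) \<partial>lborel)"
    by (subst nn_integral_cmult, measurable,
      subst nn_integral_substitution_inj[OF _ _ bij(2) deriv(2)]) (auto simp: ac_simps)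
  also have "\<dots> = (\<integral>\<^sup>+x. indicator C x * (\<integral>\<^sup>+y. indicator D y * f (x, y) \<partial>lborel) \<partial>lborel)"
    by (rule nn_integral_substitution_inj[OF _ _ bij(1) deriv(1)]) auto
  also have "\<dots> = (\<integral>\<^sup>+x. \<integral>\<^sup>+y. indicator (C \<times> D) (x, y) * f (x, y) \<partial>lborel \<partial>lborel)"
    by (subst nn_integral_cmult[symmetric]) (auto simp: indicator_times ac_simps)
  also have "\<dots> = (\<integral>\<^sup>+p. indicator (C \<times> D) p * f p \<partial>lborel)"
    by (subst lborel.nn_integral_fst) (simp_all add: lborel_prod)
  finally show ?thesis .
qed

text \<open>Branch \<open>i\<close> pushes forward the part of \<open>w\<close> on
  \<open>A i \<times> B i\<close>, and \<open>wv\<close> is its Jacobian identity. The domains have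
  to exhaust \<open>w\<close> only almost everywhere, and images may overlap, since \<open>u\<close>
  adds up \<open>v\<close> over all image rectangles. This fits both \<open>sigma_e\<close>,
  bijective up to null sets, and the two-to-one map \<open>proj_e \<circ> K_e\<close>.\<close>

lemma distr_density_piecewise:
  fixes T :: "real \<times> real \<Rightarrow> real \<times> real" and v w u :: "real \<times> real \<Rightarrow> ennreal"
    and g g' h h' :: "'i \<Rightarrow> real \<Rightarrow> real"
  assumes [measurable]: "T \<in> borel_measurable borel" "w \<in> borel_measurable borel"
      "v \<in> borel_measurable borel" "u \<in> borel_measurable borel"
    and [measurable]: "\<And>i. i \<in> I \<Longrightarrow> A i \<in> sets borel" "\<And>i. i \<in> I \<Longrightarrow> B i \<in> sets borel"
      "\<And>i. i \<in> I \<Longrightarrow> C i \<in> sets borel" "\<And>i. i \<in> I \<Longrightarrow> D i \<in> sets borel"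
      "\<And>i. i \<in> I \<Longrightarrow> g i \<in> borel_measurable borel" "\<And>i. i \<in> I \<Longrightarrow> g' i \<in> borel_measurable borel"
      "\<And>i. i \<in> I \<Longrightarrow> h i \<in> borel_measurable borel" "\<And>i. i \<in> I \<Longrightarrow> h' i \<in> borel_measurable borel"
    and bij: "\<And>i. i \<in> I \<Longrightarrow> bij_betw (g i) (A i) (C i)" "\<And>i. i \<in> I \<Longrightarrow> bij_betw (h i) (B i) (D i)"
    and deriv: "\<And>i x. i \<in> I \<Longrightarrow> x \<in> A i \<Longrightarrow> (g i has_real_derivative g' i x) (at x)"
      "\<And>i y. i \<in> I \<Longrightarrow> y \<in> B i \<Longrightarrow> (h i has_real_derivative h' i y) (at y)"
    and T: "\<And>i x y. i \<in> I \<Longrightarrow> x \<in> A i \<Longrightarrow> y \<in> B i \<Longrightarrow> T (x, y) = (g i x, h i y)"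
    and wv: "\<And>i x y. i \<in> I \<Longrightarrow> x \<in> A i \<Longrightarrow> y \<in> B i \<Longrightarrow>
      w (x, y) = v (g i x, h i y) * ennreal \<bar>g' i x * h' i y\<bar>"
    and w: "AE p in lborel. w p = (\<Sum>i\<in>I. indicator (A i \<times> B i) p * w p)"
    and u: "AE p in lborel. u p = (\<Sum>i\<in>I. indicator (C i \<times> D i) p * v p)"
  shows "distr (density lborel w) borel T = density lborel u" (is "?M = ?N")
proof (rule measure_eqI)
  fix X assume "X \<in> sets ?M"
  then have X [measurable]: "X \<in> sets borel" by simp
  have AB [measurable]: "A i \<times> B i \<in> sets borel" "C i \<times> D i \<in> sets borel" if "i \<in> I" for i
    using that by (auto simp flip: borel_prod)
  have [measurable]: "T -` X \<in> sets borel"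
    using measurable_sets[of T borel borel X] by simp
  have "emeasure ?M X = (\<integral>\<^sup>+p. w p * indicator X (T p) \<partial>lborel)"
    by (auto simp: emeasure_distr emeasure_density intro!: nn_integral_cong split: split_indicator)
  also have "\<dots> = (\<integral>\<^sup>+p. (\<Sum>i\<in>I. indicator (A i \<times> B i) p * (w p * indicator X (T p))) \<partial>lborel)"
    by (rule nn_integral_cong_AE, use w in eventually_elim) (metis (no_types, lifting) mult.assoc sum_distrib_right sum.cong)
  also have "\<dots> = (\<Sum>i\<in>I. \<integral>\<^sup>+p. indicator (A i \<times> B i) p * (w p * indicator X (T p)) \<partial>lborel)"
    by (rule nn_integral_sum) measurable
  also have "\<dots> = (\<Sum>i\<in>I. \<integral>\<^sup>+p. indicator (C i \<times> D i) p * (v p * indicator X p) \<partial>lborel)"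
  proof (rule sum.cong)
    fix i assume i [measurable]: "i \<in> I"
    have "(\<integral>\<^sup>+p. indicator (A i \<times> B i) p * (w p * indicator X (T p)) \<partial>lborel)
      = (\<integral>\<^sup>+(x, y). indicator (A i \<times> B i) (x, y) * ((v (g i x, h i y) * indicator X (g i x, h i y))
          * ennreal \<bar>g' i x * h' i y\<bar>) \<partial>lborel)"
      using i by (intro nn_integral_cong) (auto simp: T wv ac_simps indicator_times split: split_indicator)
    also have "\<dots> = (\<integral>\<^sup>+p. indicator (C i \<times> D i) p * (v p * indicator X p) \<partial>lborel)"
      using i by (intro nn_integral_substitution_rectangle bij deriv) auto
    finally show "(\<integral>\<^sup>+p. indicator (A i \<times> B i) p * (w p * indicator X (T p)) \<partial>lborel) = \<dots>" .
  qed simp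
  also have "\<dots> = (\<integral>\<^sup>+p. (\<Sum>i\<in>I. indicator (C i \<times> D i) p * (v p * indicator X p)) \<partial>lborel)"
    by (rule nn_integral_sum[symmetric]) measurable
  also have "\<dots> = (\<integral>\<^sup>+p. u p * indicator X p \<partial>lborel)"
    by (rule nn_integral_cong_AE, use u in eventually_elim) (metis (no_types, lifting) mult.assoc sum_distrib_right sum.cong)
  also have "\<dots> = emeasure ?N X"
    by (simp add: emeasure_density)
  finally show "emeasure ?M X = emeasure ?N X" .
qed simp

text \<open>Finitely many horizontal and vertical lines are null. This discards the poles and the
  edges of all rectangles that occur below.\<close>

lemma AE_lborel_coordinates_notin:
  fixes S :: "real set"
  assumes "finite S"
  shows "AE p in lborel. fst p \<notin> S \<and> snd p \<notin> S"
proof -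
  have "S \<in> null_sets lborel"
    using assms by (simp add: finite_imp_null_set_lborel)
  then have S: "AE x in lborel. x \<notin> S"
    by (rule AE_not_in)
  have [measurable]: "S \<in> sets borel"
    using assms by (simp add: finite_imp_closed borel_closed)
  have "AE p in lborel \<Otimes>\<^sub>M (lborel :: real measure). fst p \<notin> S \<and> snd p \<notin> S"
    by (rule lborel_pair.AE_pair_measure) (measurable, use S in auto)
  then show ?thesis by (simp only: lborel_prod)
qed

section \<open>The branches as bijections between intervals\<close>

context
  fixes \<epsilon> :: real
  assumes \<epsilon>: "\<epsilon> \<in> {1, -1}"
begin

text \<open>Here \<open>\<epsilon>\<close> is the sign of a half of \<open>T_e\<close>, and
  conditions on \<open>\<epsilon> * x\<close> treat both halves at once. The two claims serve the
  first and the second coordinate.\<close>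

lemma bij_betw_shift:
  "bij_betw (\<lambda>x. x - 2 * \<epsilon>) {x. 3 < \<epsilon> * x} {x. 1 < \<epsilon> * x}"
  "bij_betw (\<lambda>x. x - 2 * \<epsilon>) {x. \<epsilon> * x < 1} {x. \<epsilon> * x < -1}"
  by (rule bij_betw_byWitness[where f' = "\<lambda>x. x + 2 * \<epsilon>"]; use \<epsilon> in \<open>auto\<close>)+

text \<open>The pole \<open>2 * \<epsilon>\<close> splits the domain of the first coordinate: beyond
  it the image lies on the opposite side, before it the sign is kept. The third claim serves the
  second coordinate, which never meets the pole.\<close>

lemma bij_betw_inversion:
  "bij_betw (\<lambda>x. 1 / (2 * \<epsilon> - x)) {x. 2 < \<epsilon> * x \<and> \<epsilon> * x < 3} {x. \<epsilon> * x < -1}"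
  "bij_betw (\<lambda>x. 1 / (2 * \<epsilon> - x)) {x. 1 < \<epsilon> * x \<and> \<epsilon> * x < 2} {x. 1 < \<epsilon> * x}"
  "bij_betw (\<lambda>x. 1 / (2 * \<epsilon> - x)) {x. \<epsilon> * x < 1} {x. 0 < \<epsilon> * x \<and> \<epsilon> * x < 1}"
  by (rule bij_betw_byWitness[where f' = "\<lambda>x. 2 * \<epsilon> - 1 / x"]; use \<epsilon> in \<open>auto simp: field_simps\<close>)+

lemma bij_betw_K_e_coordinates:
  "bij_betw (\<lambda>x. \<epsilon> / x) {x. 1 < \<epsilon> * x} {0<..<1}"
  "bij_betw (\<lambda>y. 1 / (2 - \<epsilon> * y)) {y. \<epsilon> * y < 1} {0<..<1}"
  by (rule bij_betw_byWitness[where f' = "\<lambda>x. \<epsilon> / x"]; use \<epsilon> in \<open>auto simp: field_simps\<close>)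
    (rule bij_betw_byWitness[where f' = "\<lambda>y. \<epsilon> * (2 - 1 / y)"]; use \<epsilon> in \<open>auto simp: field_simps\<close>)

end

lemma measurable_sigma_e [measurable]: "sigma_e \<in> borel_measurable borel"
  unfolding sigma_e_def borel_prod[symmetric] Let_def sgn_if by measurable

lemma measurable_proj_K_e [measurable]: "proj_e \<circ> K_e \<in> borel_measurable borel"
proof -
  have "proj_e \<circ> K_e = (\<lambda>(x, y). (sgn x / x, 1 / (2 - sgn x * y)))"
    by (auto simp: fun_eq_iff proj_e_def K_e_def Let_def)
  then show ?thesis
    unfolding borel_prod[symmetric] sgn_if by simp
qed

lemma measurable_F_bar_e [measurable]: "F_bar_e \<in> borel_measurable borel"
  unfolding F_bar_e_def borel_prod[symmetric] by measurable

section \<open>Invariance of \<open>mu_sigma_e\<close>\<close>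

text \<open>The half of \<open>T_e\<close> with sign \<epsilon> is tiled by three images, stacked in
  the second coordinate: the shift fills \<open>\<epsilon> * y < -1\<close>, the inversion before
  the pole fills \<open>0 < \<epsilon> * y < 1\<close>, and the strip
  \<open>-1 < \<epsilon> * y < 0\<close> comes from the other half, by the inversion beyond its
  pole.\<close>

lemma distr_sigma_e: "distr mu_sigma_e borel sigma_e = mu_sigma_e"
proof -
  have [measurable]: "T_e \<in> sets (borel \<Otimes>\<^sub>M borel)" by (simp add: T_e_def)
  have [measurable]: "(\<lambda>p. ennreal (indicator T_e p / (fst p - snd p)\<^sup>2)) \<in> borel_measurable borel"
    "(\<lambda>p. ennreal (1 / (fst p - snd p)\<^sup>2)) \<in> borel_measurable borel"
    by (simp_all flip: borel_prod)
  \<comment> \<open>The branches of the map: for each sign the shift (0) and the inversion on either side of its pole (1 and 2).\<close>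
  define I :: "(real \<times> nat) set" where "I = {1, -1} \<times> {0, 1, 2}"
  define A where "A = (\<lambda>(\<epsilon>, i :: nat). if i = 0 then {x. 3 < \<epsilon> * x}
    else if i = 1 then {x. 2 < \<epsilon> * x \<and> \<epsilon> * x < 3} else {x :: real. 1 < \<epsilon> * x \<and> \<epsilon> * x < 2})"
  define B where "B = (\<lambda>(\<epsilon>, i :: nat). {y :: real. \<epsilon> * y < 1})"
  define C where "C = (\<lambda>(\<epsilon>, i :: nat). if i = 1 then {x :: real. \<epsilon> * x < -1} else {x. 1 < \<epsilon> * x})"
  define D where "D = (\<lambda>(\<epsilon>, i :: nat). if i = 0 then {y :: real. \<epsilon> * y < -1} else {y. 0 < \<epsilon> * y \<and> \<epsilon> * y < 1})"
  define g where "g = (\<lambda>(\<epsilon>, i :: nat) x :: real. if i = 0 then x - 2 * \<epsilon> else 1 / (2 * \<epsilon> - x))"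
  define g' where "g' = (\<lambda>(\<epsilon>, i :: nat) x :: real. if i = 0 then 1 else 1 / (2 * \<epsilon> - x)\<^sup>2)"
  note defs = I_def A_def B_def C_def D_def g_def g'_def
  have I: "\<exists>\<epsilon>\<in>{1, -1}. i = (\<epsilon>, 0) \<or> i = (\<epsilon>, 1) \<or> i = (\<epsilon>, 2)" if "i \<in> I" for i
    using that by (auto simp: I_def)
  have "distr (density lborel (\<lambda>p. ennreal (indicator T_e p / (fst p - snd p)\<^sup>2))) borel sigma_e
    = density lborel (\<lambda>p. ennreal (indicator T_e p / (fst p - snd p)\<^sup>2))"
  proof (rule distr_density_piecewise[where I = I and A = A and B = B and C = C and D = D
        and g = g and g' = g' and h = g and h' = g' and v = "\<lambda>p. ennreal (1 / (fst p - snd p)\<^sup>2)"])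
    fix i assume i: "i \<in> I"
    obtain \<epsilon> where \<epsilon>: "\<epsilon> \<in> {1, -1}" and "i = (\<epsilon>, 0) \<or> i = (\<epsilon>, 1) \<or> i = (\<epsilon>, 2)"
      using I[OF i] by blast
    then show "bij_betw (g i) (A i) (C i)" "bij_betw (g i) (B i) (D i)"
      using bij_betw_shift[OF \<epsilon>] bij_betw_inversion[OF \<epsilon>]
      by (elim disjE; simp add: A_def B_def C_def D_def g_def)+
    show "A i \<in> sets borel" "B i \<in> sets borel" "C i \<in> sets borel" "D i \<in> sets borel"
      using I[OF i] by (auto simp: defs)
    show "g i \<in> borel_measurable borel" "g' i \<in> borel_measurable borel"
      "g i \<in> borel_measurable borel" "g' i \<in> borel_measurable borel"
      using I[OF i] by (auto simp: defs)
    show "(g i has_real_derivative g' i x) (at x)" if "x \<in> A i" for x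
      using I[OF i] that
      by (auto simp: defs power2_eq_square intro!: derivative_eq_intros)
    show "(g i has_real_derivative g' i x) (at x)" if "x \<in> B i" for x
      using I[OF i] that
      by (auto simp: defs power2_eq_square intro!: derivative_eq_intros)
    fix x y assume xy: "x \<in> A i" "y \<in> B i"
    show "sigma_e (x, y) = (g i x, g i y)"
      using I[OF i] xy by (auto simp: defs sigma_e_def sgn_if)
    have "(x, y) \<in> T_e"
      using I[OF i] xy by (auto simp: defs T_e_def)
    moreover have "1 / (x - y)\<^sup>2 = 1 / (g i x - g i y)\<^sup>2 * \<bar>g' i x * g' i y\<bar>"
    \<comment> \<open>The shift preserves differences. For the inversion, the difference of the
      images is \<open>x - y\<close> divided by the product of the two denominators, whose squares
      are what the derivatives contribute.\<close>
    proof (cases "snd i = 0")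
      case True
      then show ?thesis by (auto simp: g_def g'_def split: prod.splits)
    next
      case False
      have "2 * fst i - x \<noteq> 0" "2 * fst i - y \<noteq> 0"
        using I[OF i] xy by (auto simp: defs)
      moreover from this have "1 / (2 * fst i - x) - 1 / (2 * fst i - y)
          = (x - y) / ((2 * fst i - x) * (2 * fst i - y))"
        by (simp add: field_simps)
      ultimately show ?thesis using False
        by (simp add: g_def g'_def case_prod_unfold power_mult_distrib power_divide)
    qed
    ultimately show "ennreal (indicator T_e (x, y) / (fst (x, y) - snd (x, y))\<^sup>2)
      = ennreal (1 / (fst (g i x, g i y) - snd (g i x, g i y))\<^sup>2) * ennreal \<bar>g' i x * g' i y\<bar>"
      by (simp flip: ennreal_mult)
  next
    have sum: "(\<Sum>i\<in>I. indicator (E i \<times> F i) p * c)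
      = (\<Sum>\<epsilon>\<in>{1, -1}. indicator (E (\<epsilon>, 0)) (fst p) * indicator (F (\<epsilon>, 0)) (snd p)
          + indicator (E (\<epsilon>, 1)) (fst p) * indicator (F (\<epsilon>, 1)) (snd p)
          + indicator (E (\<epsilon>, 2)) (fst p) * indicator (F (\<epsilon>, 2)) (snd p)) * c"
      for E F :: "_ \<Rightarrow> real set" and p and c :: ennreal
      by (cases p) (simp add: I_def sum.cartesian_product' indicator_times distrib_right add.assoc)
    show "AE p in lborel. ennreal (indicator T_e p / (fst p - snd p)\<^sup>2)
      = (\<Sum>i\<in>I. indicator (A i \<times> B i) p * ennreal (indicator T_e p / (fst p - snd p)\<^sup>2))"
      \<comment> \<open>Removed are the poles and the lines that separate shift from
        inversion.\<close>
      using AE_lborel_coordinates_notin[of "set [2, -2, 3, -3]", OF finite_set]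
    proof eventually_elim
      case (elim p)
      obtain x y where p: "p = (x, y)" by (cases p)
      consider "p \<notin> T_e" | "1 < x" "y < 1" | "x < -1" "-1 < y"
        by (auto simp: p T_e_def)
      then show ?case
      proof cases
        case 1
        then show ?thesis by simp
      next
        case 2
        with elim consider "3 < x" | "2 < x" "x < 3" | "x < 2"
          by (fastforce simp: p)
        then show ?thesis
          using 2 unfolding sum by cases (simp_all add: p A_def B_def T_e_def)
      next
        case 3
        with elim consider "x < -3" | "-3 < x" "x < -2" | "-2 < x"
          by (fastforce simp: p)
        then show ?thesis
          using 3 unfolding sum by cases (simp_all add: p A_def B_def T_e_def)
      qed
    qed
    show "AE p in lborel. ennreal (indicator T_e p / (fst p - snd p)\<^sup>2)
      = (\<Sum>i\<in>I. indicator (C i \<times> D i) p * ennreal (1 / (fst p - snd p)\<^sup>2))"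
      \<comment> \<open>Removed are the edges of the image rectangles. The density \<open>v\<close>
        carries no indicator of \<open>T_e\<close>: the images all lie in \<open>T_e\<close>, so
        their sum supplies it.\<close>
      using AE_lborel_coordinates_notin[of "set [0, 1, -1]", OF finite_set]
    proof eventually_elim
      case (elim p)
      obtain x y where p: "p = (x, y)" by (cases p)
      consider "-1 \<le> x" "x \<le> 1" | "1 < x" | "x < -1"
        by linarith
      then show ?case
      proof cases
        case 1
        then show ?thesis
          unfolding sum by (simp add: p C_def D_def T_e_def)
      next
        case 2
        from elim consider "1 \<le> y" | "0 < y" "y < 1" | "-1 < y" "y < 0" | "y < -1"
          by (fastforce simp: p)
        then show ?thesis
          using 2 unfolding sum by cases (simp_all add: p C_def D_def T_e_def)
      next
        case 3
        from elim consider "1 < y" | "0 < y" "y < 1" | "-1 < y" "y < 0" | "y \<le> -1"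
          by (fastforce simp: p)
        then show ?thesis
          using 3 unfolding sum by cases (simp_all add: p C_def D_def T_e_def)
      qed
    qed
  qed measurable
  then show ?thesis
    by (simp add: mu_sigma_e_def case_prod_unfold)
qed

section \<open>The image measure on the unit square\<close>

text \<open>For \<open>X = \<epsilon> / x\<close> and \<open>Y = 1 / (2 - \<epsilon> * y)\<close>
  one has \<open>X + Y - 2 * X * Y = (x - y) / (x * (2 - \<epsilon> * y))\<close>, and the Jacobian
  has modulus \<open>1 / (x * (2 - \<epsilon> * y))\<^sup>2\<close>, so the densities match. Both
  signs have the same open square as image, hence two equal summands.\<close>

lemma distr_proj_K_e: "distr mu_sigma_e borel (proj_e \<circ> K_e) = scale_measure 2 mu_F_e"
proof -
  have [measurable]: "T_e \<in> sets (borel \<Otimes>\<^sub>M borel)" "unit_square \<in> sets (borel \<Otimes>\<^sub>M borel)"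
    by (simp_all add: T_e_def unit_square_def)
  have [measurable]: "(\<lambda>p. ennreal (indicator T_e p / (fst p - snd p)\<^sup>2)) \<in> borel_measurable borel"
    "(\<lambda>p. ennreal (1 / (fst p + snd p - 2 * fst p * snd p)\<^sup>2)) \<in> borel_measurable borel"
    "(\<lambda>p. ennreal (indicator unit_square p / (fst p + snd p - 2 * fst p * snd p)\<^sup>2)) \<in> borel_measurable borel"
    by (simp_all flip: borel_prod)
  have "distr (density lborel (\<lambda>p. ennreal (indicator T_e p / (fst p - snd p)\<^sup>2))) borel (proj_e \<circ> K_e)
    = density lborel (\<lambda>p. 2 * ennreal (indicator unit_square p / (fst p + snd p - 2 * fst p * snd p)\<^sup>2))"
  proof (rule distr_density_piecewise[where I = "{1, -1}"
        and A = "\<lambda>\<epsilon>. {x. 1 < \<epsilon> * x}" and B = "\<lambda>\<epsilon>. {y. \<epsilon> * y < 1}"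
        and C = "\<lambda>\<epsilon>. {0<..<1}" and D = "\<lambda>\<epsilon>. {0<..<1}"
        and g = "\<lambda>\<epsilon> x. \<epsilon> / x" and g' = "\<lambda>\<epsilon> x. - \<epsilon> / x\<^sup>2"
        and h = "\<lambda>\<epsilon> y. 1 / (2 - \<epsilon> * y)" and h' = "\<lambda>\<epsilon> y. \<epsilon> / (2 - \<epsilon> * y)\<^sup>2"
        and v = "\<lambda>p. ennreal (1 / (fst p + snd p - 2 * fst p * snd p)\<^sup>2)"])
    fix \<epsilon> :: real assume \<epsilon>: "\<epsilon> \<in> {1, -1}"
    show "bij_betw (\<lambda>x. \<epsilon> / x) {x. 1 < \<epsilon> * x} {0<..<1}"
      "bij_betw (\<lambda>y. 1 / (2 - \<epsilon> * y)) {y. \<epsilon> * y < 1} {0<..<1}"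
      using bij_betw_K_e_coordinates[OF \<epsilon>] by simp_all
    show "((\<lambda>x. \<epsilon> / x) has_real_derivative - \<epsilon> / x\<^sup>2) (at x)" if "x \<in> {x. 1 < \<epsilon> * x}" for x
      using that by (auto simp: power2_eq_square intro!: derivative_eq_intros)
    show "((\<lambda>y. 1 / (2 - \<epsilon> * y)) has_real_derivative \<epsilon> / (2 - \<epsilon> * y)\<^sup>2) (at y)" if "y \<in> {y. \<epsilon> * y < 1}" for y
      using that by (auto simp: power2_eq_square intro!: derivative_eq_intros)
    fix x y assume xy: "x \<in> {x. 1 < \<epsilon> * x}" "y \<in> {y. \<epsilon> * y < 1}"
    then have T: "(x, y) \<in> T_e" and nz: "x \<noteq> 0" "2 - \<epsilon> * y \<noteq> 0" and sgn: "sgn x = \<epsilon>"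
      using \<epsilon> by (auto simp: T_e_def sgn_if)
    show "(proj_e \<circ> K_e) (x, y) = (\<epsilon> / x, 1 / (2 - \<epsilon> * y))"
      by (simp add: proj_e_def K_e_def sgn)
    have "\<epsilon> / x + 1 / (2 - \<epsilon> * y) - 2 * (\<epsilon> / x) * (1 / (2 - \<epsilon> * y)) = (x - y) / (x * (2 - \<epsilon> * y))"
      using \<epsilon> nz by (auto simp: divide_simps)
    then have "1 / (x - y)\<^sup>2 = 1 / (\<epsilon> / x + 1 / (2 - \<epsilon> * y) - 2 * (\<epsilon> / x) * (1 / (2 - \<epsilon> * y)))\<^sup>2
        * \<bar>- \<epsilon> / x\<^sup>2 * (\<epsilon> / (2 - \<epsilon> * y)\<^sup>2)\<bar>"
      using \<epsilon> nz by (auto simp: abs_mult power_mult_distrib power_divide)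
    with T show "ennreal (indicator T_e (x, y) / (fst (x, y) - snd (x, y))\<^sup>2)
      = ennreal (1 / (fst (\<epsilon> / x, 1 / (2 - \<epsilon> * y)) + snd (\<epsilon> / x, 1 / (2 - \<epsilon> * y))
          - 2 * fst (\<epsilon> / x, 1 / (2 - \<epsilon> * y)) * snd (\<epsilon> / x, 1 / (2 - \<epsilon> * y)))\<^sup>2)
        * ennreal \<bar>- \<epsilon> / x\<^sup>2 * (\<epsilon> / (2 - \<epsilon> * y)\<^sup>2)\<bar>"
      by (simp flip: ennreal_mult)
  next
    have sum: "sum F {1, -1} = F 1 + F (-1)" for F :: "real \<Rightarrow> ennreal"
      by simp
    show "AE p in lborel. ennreal (indicator T_e p / (fst p - snd p)\<^sup>2)
      = (\<Sum>\<epsilon>\<in>{1, -1}. indicator ({x. 1 < \<epsilon> * x} \<times> {y. \<epsilon> * y < 1}) p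
          * ennreal (indicator T_e p / (fst p - snd p)\<^sup>2))"
      unfolding sum by (intro AE_I2) (auto simp: T_e_def split: split_indicator)
    show "AE p in lborel. 2 * ennreal (indicator unit_square p / (fst p + snd p - 2 * fst p * snd p)\<^sup>2)
      = (\<Sum>\<epsilon>\<in>{1, - 1 :: real}. indicator ({0<..<1} \<times> {0<..<1}) p
          * ennreal (1 / (fst p + snd p - 2 * fst p * snd p)\<^sup>2))"
      using AE_lborel_coordinates_notin[of "set [0, 1]", OF finite_set]
    proof eventually_elim
      case (elim p)
      then have "p \<in> unit_square \<longleftrightarrow> p \<in> {0<..<1} \<times> {0<..<1}"
        by (cases p) (auto simp: unit_square_def)
      then show ?case
        unfolding sum mult_2 by (cases "p \<in> unit_square") simp_all
    qed
  qed measurable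
  then have "distr mu_sigma_e borel (proj_e \<circ> K_e)
    = density lborel (\<lambda>p. 2 * ennreal (indicator unit_square p / (fst p + snd p - 2 * fst p * snd p)\<^sup>2))"
    by (simp add: mu_sigma_e_def case_prod_unfold)
  also have "\<dots> = scale_measure 2 mu_F_e"
  proof (rule measure_eqI)
    let ?w = "\<lambda>p. ennreal (indicator unit_square p / (fst p + snd p - 2 * fst p * snd p)\<^sup>2)"
    fix X assume "X \<in> sets (density lborel (\<lambda>p. 2 * ?w p))"
    then have X [measurable]: "X \<in> sets lborel" by simp
    have w: "?w \<in> borel_measurable lborel"
      by (simp flip: borel_prod)
    then have w2: "(\<lambda>p. 2 * ?w p) \<in> borel_measurable lborel"
      by (rule borel_measurable_times_ennreal[OF borel_measurable_const])
    have "emeasure (density lborel (\<lambda>p. 2 * ?w p)) X = (\<integral>\<^sup>+p. 2 * (?w p * indicator X p) \<partial>lborel)"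
      unfolding emeasure_density[OF w2 X] by (simp only: mult.assoc)
    also have "\<dots> = 2 * (\<integral>\<^sup>+p. ?w p * indicator X p \<partial>lborel)"
      by (rule nn_integral_cmult) measurable
    also have "\<dots> = emeasure (scale_measure 2 mu_F_e) X"
      unfolding emeasure_scale_measure mu_F_e_def case_prod_unfold prod.collapse
      by (simp only: emeasure_density[OF w X])
    finally show "emeasure (density lborel (\<lambda>p. 2 * ?w p)) X = emeasure (scale_measure 2 mu_F_e) X" .
  qed (simp add: mu_F_e_def)
  finally show ?thesis .
qed

section \<open>The pointwise conjugacy\<close>

lemma sigma_e_in_T_e:
  assumes "p \<in> T_e" "\<bar>fst p\<bar> \<noteq> 2" "\<bar>fst p\<bar> \<noteq> 3"
  shows "sigma_e p \<in> T_e"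
proof -
  obtain x y where p: "p = (x, y)" by (cases p)
  define \<epsilon> where "\<epsilon> = sgn x"
  have \<epsilon>: "\<epsilon> = 1 \<or> \<epsilon> = -1" and x: "1 < \<epsilon> * x" and y: "\<epsilon> * y < 1"
      and x23: "\<epsilon> * x \<noteq> 2" "\<epsilon> * x \<noteq> 3"
    using assms unfolding p \<epsilon>_def by (auto simp: T_e_def sgn_if split: if_splits)
  have sigma: "sigma_e p = (if 3 < \<epsilon> * x then (x - 2 * \<epsilon>, y - 2 * \<epsilon>)
      else (1 / (2 * \<epsilon> - x), 1 / (2 * \<epsilon> - y)))"
    by (simp add: p sigma_e_def Let_def \<epsilon>_def)
  consider "3 < \<epsilon> * x" | "2 < \<epsilon> * x" "\<epsilon> * x < 3" | "\<epsilon> * x < 2"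
    using x23 by linarith
  then show ?thesis
    by cases (use \<epsilon> x y in \<open>auto simp: sigma T_e_def divide_simps\<close>)
qed

text \<open>Under \<open>X = \<epsilon> / x\<close> the thresholds 3 and 2 for
  \<open>\<epsilon> * x\<close> become 1/3 and 1/2, the thresholds of \<open>F_bar_e\<close>. Only
  between them does \<open>sigma_e\<close> change the sign of the first coordinate, which is the
  flip in \<open>F_tilde_e\<close>. At \<open>\<bar>x\<bar> = 2\<close> the equation fails:
  \<open>sigma_e\<close> returns first coordinate 0, whose sign is 0. At
  \<open>\<bar>x\<bar> = 3\<close> it holds although the image leaves \<open>T_e\<close>.\<close>

lemma K_e_sigma_e:
  assumes "p \<in> T_e" "\<bar>fst p\<bar> \<noteq> 2"
  shows "K_e (sigma_e p) = F_tilde_e (K_e p)"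
proof -
  obtain x y where p: "p = (x, y)" by (cases p)
  define \<epsilon> where "\<epsilon> = sgn x"
  have \<epsilon>: "\<epsilon> = 1 \<or> \<epsilon> = -1" and x: "1 < \<epsilon> * x" and y: "\<epsilon> * y < 1" and x2: "\<epsilon> * x \<noteq> 2"
    using assms unfolding p \<epsilon>_def by (auto simp: T_e_def sgn_if split: if_splits)
  have nz: "x \<noteq> 0" "2 - \<epsilon> * y \<noteq> 0"
    using x y by auto
  have K: "K_e p = (\<epsilon> / x, 1 / (2 - \<epsilon> * y), \<epsilon>)"
    by (simp add: p K_e_def Let_def \<epsilon>_def)
  consider "3 < \<epsilon> * x" | "2 < \<epsilon> * x" "\<epsilon> * x \<le> 3" | "\<epsilon> * x < 2"
    using x2 by linarith
  then show ?thesis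
  proof cases
    case 1
    then have "sgn (x - 2 * \<epsilon>) = \<epsilon>" "\<epsilon> / x < 1 / 3"
      using \<epsilon> by (auto simp: field_simps)
    moreover have "sigma_e p = (x - 2 * \<epsilon>, y - 2 * \<epsilon>)"
      using 1 by (simp add: p sigma_e_def Let_def \<epsilon>_def)
    moreover have "1 - 2 * (\<epsilon> / x) = (x - 2 * \<epsilon>) / x" "1 + 2 * (1 / (2 - \<epsilon> * y)) = (4 - \<epsilon> * y) / (2 - \<epsilon> * y)"
      using nz by (auto simp: field_simps)
    moreover have "2 - \<epsilon> * (y - 2 * \<epsilon>) = 4 - \<epsilon> * y"
      using \<epsilon> by auto
    ultimately show ?thesis
      using nz unfolding K by (simp add: K_e_def Let_def F_tilde_e_def F_bar_e_def del: diff_divide_distrib)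
  next
    case 2
    then have le: "1 / 3 \<le> \<epsilon> / x" "\<epsilon> / x < 1 / 2"
      using \<epsilon> by (auto simp: field_simps)
    have "sgn (1 / (2 * \<epsilon> - x)) = - \<epsilon>"
      using 2 \<epsilon> by (auto simp: sgn_if)
    moreover have "sigma_e p = (1 / (2 * \<epsilon> - x), 1 / (2 * \<epsilon> - y))"
      using 2 by (simp add: p sigma_e_def Let_def \<epsilon>_def)
    \<comment> \<open>The new sign is \<open>- \<epsilon>\<close>, so
      \<open>2 - \<epsilon> * y\<close> turns into \<open>2 + \<epsilon> * y'\<close> for the new
      second coordinate \<open>y'\<close>, and
      \<open>\<epsilon> / (2 * \<epsilon> - y) = 1 / (2 - \<epsilon> * y)\<close>.\<close>
    ultimately have "K_e (sigma_e p) = (\<epsilon> * x - 2, 1 / (2 + 1 / (2 - \<epsilon> * y)), - \<epsilon>)"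
      using \<epsilon> by (elim disjE) (simp_all add: K_e_def Let_def minus_divide_right)
    moreover have "(1 - 2 * (\<epsilon> / x)) / (\<epsilon> / x) = \<epsilon> * x - 2"
      using nz \<epsilon> by (auto simp: field_simps)
    ultimately show ?thesis
      using le unfolding K by (simp add: F_tilde_e_def F_bar_e_def)
  next
    case 3
    then have "sgn (1 / (2 * \<epsilon> - x)) = \<epsilon>" "\<not> \<epsilon> / x < 1 / 3" "\<not> \<epsilon> / x < 1 / 2"
      using \<epsilon> x by (auto simp: field_simps sgn_if)
    moreover have "sigma_e p = (1 / (2 * \<epsilon> - x), 1 / (2 * \<epsilon> - y))"
      using 3 by (simp add: p sigma_e_def Let_def \<epsilon>_def)
    ultimately show ?thesis
      using 3 \<epsilon> x y unfolding K by (auto simp: K_e_def Let_def F_tilde_e_def F_bar_e_def divide_simps) (simp add: algebra_simps)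
  qed
qed

section \<open>Invertibility of \<open>K_e\<close> and the range of the maps\<close>

text \<open>The third component remembers the half of \<open>T_e\<close>; given it, the two
  coordinate equations are solved separately, which yields the witness for the inverse.\<close>

lemma bij_betw_K_e:
  "bij_betw K_e T_e {(x, y, \<delta>). x \<in> {0<..<1} \<and> y \<in> {0<..<1} \<and> \<delta> \<in> {1, -1}}"
    (is "bij_betw _ _ ?S")
proof (rule bij_betw_byWitness[where f' = "\<lambda>(x, y, \<delta>). (\<delta> / x, \<delta> * (2 - 1 / y))"])
  let ?f' = "\<lambda>(x, y, \<delta>). (\<delta> / x, \<delta> * (2 - 1 / y))"
  have K: "K_e p \<in> ?S" "?f' (K_e p) = p" if T: "p \<in> T_e" for p
  proof -
    obtain x y where p: "p = (x, y)" by (cases p)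
    consider "sgn x = 1" "1 < x" "y < 1" | "sgn x = -1" "x < -1" "-1 < y"
      using T by (auto simp: p T_e_def)
    then show "K_e p \<in> ?S" "?f' (K_e p) = p"
      by (cases; auto simp: p K_e_def Let_def divide_simps)+
  qed
  show "\<forall>p\<in>T_e. ?f' (K_e p) = p" "K_e ` T_e \<subseteq> ?S"
    by (intro ballI image_subsetI K; assumption)+
  have f': "?f' q \<in> T_e" "K_e (?f' q) = q" if "q \<in> ?S" for q
  proof -
    obtain x y \<delta> where q: "q = (x, y, \<delta>)" by (cases q)
    have xy: "0 < x" "x < 1" "0 < y" "y < 1" and \<delta>: "\<delta> = 1 \<or> \<delta> = -1"
      using that by (auto simp: q)
    from xy \<delta> have "sgn (\<delta> / x) = \<delta>"
      by (auto simp: sgn_if)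
    with xy \<delta> show "?f' q \<in> T_e" "K_e (?f' q) = q"
      by (auto simp: q K_e_def Let_def T_e_def field_simps)
  qed
  show "\<forall>q\<in>?S. K_e (?f' q) = q" "?f' ` ?S \<subseteq> T_e"
    by (intro ballI image_subsetI f'; assumption)+
qed

text \<open>Only points over the boundary of the square are missed, so \<open>K_e\<close> is
  invertible onto \<open>Omega_e\<close> up to a null set. The set is measured after projection
  because \<open>Omega_e\<close> lies in two planes of three-space, where smallness in volume would
  say nothing.\<close>

lemma null_sets_proj_e: "proj_e ` (Omega_e - K_e ` T_e) \<in> null_sets lborel"
proof -
  have "proj_e ` (Omega_e - K_e ` T_e) = unit_square - {0<..<1} \<times> {0<..<1}"
    unfolding bij_betw_imp_surj_on[OF bij_betw_K_e]
    by (force simp: Omega_e_def proj_e_def image_iff)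
  moreover have "AE p in lborel. p \<notin> unit_square - {0<..<1} \<times> {0<..<1}"
    using AE_lborel_coordinates_notin[of "set [0, 1]", OF finite_set]
    by eventually_elim (auto simp: unit_square_def)
  moreover have "unit_square - {0<..<1} \<times> {0<..<1} \<in> sets borel"
    by (auto simp: unit_square_def simp flip: borel_prod)
  ultimately show ?thesis
    by (simp add: AE_iff_null_sets)
qed

lemma F_bar_e_in_unit_square:
  assumes "p \<in> unit_square"
  shows "F_bar_e p \<in> unit_square"
proof -
  obtain x y where p: "p = (x, y)" by (cases p)
  have "0 \<le> x" "x \<le> 1" "0 \<le> y" "y \<le> 1"
    using assms by (auto simp: p unit_square_def)
  then show ?thesis
    unfolding p F_bar_e_def unit_square_def by (simp add: divide_simps)
qed

lemma F_tilde_e_in_Omega_e: "F_tilde_e \<in> Omega_e \<rightarrow> Omega_e"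
proof
  fix q assume "q \<in> Omega_e"
  moreover obtain x y \<delta> where "q = (x, y, \<delta>)" by (cases q)
  ultimately show "F_tilde_e q \<in> Omega_e"
    using F_bar_e_in_unit_square[of "(x, y)"] by (auto simp: Omega_e_def F_tilde_e_def)
qed

lemma proj_e_F_tilde_e: "proj_e (F_tilde_e q) = F_bar_e (proj_e q)"
  by (simp add: proj_e_def F_tilde_e_def case_prod_unfold)

section \<open>Transfer of invariance to \<open>F_bar_e\<close>\<close>

text \<open>The density vanishes off \<open>T_e\<close> and the two lines are Lebesgue null, so the
  pointwise conjugacy holds almost everywhere for \<open>mu_sigma_e\<close>.\<close>

lemma AE_mu_sigma_e: "AE p in mu_sigma_e. p \<in> T_e \<and> \<bar>fst p\<bar> \<noteq> 2"
proof -
  have [measurable]: "T_e \<in> sets (borel \<Otimes>\<^sub>M borel)" by (simp add: T_e_def)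
  have "(\<lambda>(x, y). ennreal (indicator T_e (x, y) / (x - y)\<^sup>2)) \<in> borel_measurable lborel"
    by (simp flip: borel_prod)
  moreover have "AE p in lborel. 0 < (case p of (x, y) \<Rightarrow> ennreal (indicator T_e (x, y) / (x - y)\<^sup>2))
      \<longrightarrow> p \<in> T_e \<and> \<bar>fst p\<bar> \<noteq> 2"
    using AE_lborel_coordinates_notin[of "set [2, -2]", OF finite_set]
    by eventually_elim (auto split: split_indicator_asm)
  ultimately show ?thesis
    unfolding mu_sigma_e_def by (subst AE_density)
qed

lemma invariant_measure_pushforward:
  "invariant_measure F_bar_e (distr mu_sigma_e borel (proj_e \<circ> K_e))"
proof -
  let ?L = "proj_e \<circ> K_e"
  have [measurable_cong]: "sets mu_sigma_e = sets borel" by (simp add: mu_sigma_e_def)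
  have "distr (distr mu_sigma_e borel ?L) borel F_bar_e = distr mu_sigma_e borel (F_bar_e \<circ> ?L)"
    by (simp add: distr_distr)
  also have "\<dots> = distr mu_sigma_e borel (?L \<circ> sigma_e)"
  proof (rule distr_cong_AE)
    show "AE p in mu_sigma_e. (F_bar_e \<circ> ?L) p = (?L \<circ> sigma_e) p"
      using AE_mu_sigma_e by eventually_elim (simp add: K_e_sigma_e proj_e_F_tilde_e)
  qed simp_all
  also have "\<dots> = distr (distr mu_sigma_e borel sigma_e) borel ?L"
    by (simp add: distr_distr)
  finally show ?thesis
    by (simp add: invariant_measure_def distr_sigma_e cong: distr_cong)
qed

text \<open>The pushforward is twice \<open>mu_F_e\<close>. The factor cancels on every set, even
  one of infinite measure, because 2 is neither zero nor infinite.\<close>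

lemma invariant_measure_mu_F_e: "invariant_measure F_bar_e mu_F_e"
proof -
  have [measurable_cong, simp]: "sets mu_F_e = sets borel" by (simp add: mu_F_e_def)
  have [simp]: "space mu_F_e = UNIV" by (simp add: mu_F_e_def)
  have inv: "distr (scale_measure 2 mu_F_e) (scale_measure 2 mu_F_e) F_bar_e = scale_measure 2 mu_F_e"
    using invariant_measure_pushforward by (simp add: distr_proj_K_e invariant_measure_def)
  have "distr mu_F_e mu_F_e F_bar_e = mu_F_e"
  proof (rule measure_eqI)
    fix X assume "X \<in> sets (distr mu_F_e mu_F_e F_bar_e)"
    then have [measurable]: "X \<in> sets borel" by simp
    have "2 * emeasure mu_F_e (F_bar_e -` X) = 2 * emeasure mu_F_e X"
      using arg_cong[OF inv, of "\<lambda>M. emeasure M X"] by (simp add: emeasure_distr space_scale_measure)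
    then show "emeasure (distr mu_F_e mu_F_e F_bar_e) X = emeasure mu_F_e X"
      by (simp add: emeasure_distr ennreal_mult_cancel_left)
  qed simp
  then show ?thesis by (simp add: invariant_measure_def)
qed

theorem proposition4p1:
  shows "F_tilde_e \<in> Omega_e \<rightarrow> Omega_e \<and>
    bij_betw K_e T_e {(x, y, \<delta>). x \<in> {0<..<1} \<and> y \<in> {0<..<1} \<and> \<delta> \<in> {1, -1}} \<and>
    K_e ` T_e \<subseteq> Omega_e \<and>
    proj_e ` (Omega_e - K_e ` T_e) \<in> null_sets lborel \<and>
    (\<forall>p\<in>T_e. \<bar>fst p\<bar> \<noteq> 2 \<longrightarrow> K_e (sigma_e p) = F_tilde_e (K_e p)) \<and>
    (\<forall>p\<in>T_e. \<bar>fst p\<bar> \<noteq> 2 \<and> \<bar>fst p\<bar> \<noteq> 3 \<longrightarrow> sigma_e p \<in> T_e) \<and>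
    invariant_measure sigma_e mu_sigma_e \<and>
    proj_e \<circ> K_e \<in> borel_measurable mu_sigma_e \<and>
    invariant_measure F_bar_e (distr mu_sigma_e borel (proj_e \<circ> K_e)) \<and>
    distr mu_sigma_e borel (proj_e \<circ> K_e) = scale_measure 2 mu_F_e \<and>
    invariant_measure F_bar_e mu_F_e"
proof (intro conjI)
  have [measurable_cong]: "sets mu_sigma_e = sets borel" by (simp add: mu_sigma_e_def)
  \<comment> \<open>The target measure of \<open>distr\<close> enters only through its space and
    measurable sets, which are those of \<open>borel\<close>.\<close>
  have "distr mu_sigma_e mu_sigma_e sigma_e = distr mu_sigma_e borel sigma_e"
    by (rule distr_cong) (simp_all add: mu_sigma_e_def)
  then show "invariant_measure sigma_e mu_sigma_e"
    by (simp add: invariant_measure_def distr_sigma_e)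
  show "proj_e \<circ> K_e \<in> borel_measurable mu_sigma_e"
    by measurable
  show "K_e ` T_e \<subseteq> Omega_e"
    using bij_betw_K_e by (auto simp: bij_betw_def Omega_e_def unit_square_def)
  show "\<forall>p\<in>T_e. \<bar>fst p\<bar> \<noteq> 2 \<longrightarrow> K_e (sigma_e p) = F_tilde_e (K_e p)"
    using K_e_sigma_e by blast
  show "\<forall>p\<in>T_e. \<bar>fst p\<bar> \<noteq> 2 \<and> \<bar>fst p\<bar> \<noteq> 3 \<longrightarrow> sigma_e p \<in> T_e"
    using sigma_e_in_T_e by blast
qed (rule F_tilde_e_in_Omega_e bij_betw_K_e null_sets_proj_e invariant_measure_pushforward
    distr_proj_K_e invariant_measure_mu_F_e)+

end
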